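(* Let $G$ be an Abelian group of order $n$, let $K=(k_1,\dots,k_m)$ be a tuple of positive integers, $a=\sum_{i}k_i$ and $\widetilde{k}=\mathrm{lcm}(k_1,\dots,k_m)$. A necessary condition for the existence of an $(n,m,K,a,d)$-RWEDF over $G$, or equivalently of a weak $(n,m,a,\rho)$-AMD code $(S,G,\mathcal{A},E_u)$ with $S=\{s_1,\dots,s_m\}$, $|A_{s_i}|=k_i$ for $1\le i\le m$, and $\rho=\frac{a(m-1)}{m(n-1)}$, is $(n-1)\mid \widetilde{k}a(m-1)$.
   Context: All groups are written additively with identity $0$. RWEDF: let $\mathcal{B}=\{B_i:1\le i\le m\}$ be a family of pairwise disjoint nonempty subsets of $G$ with $k_i=|B_i|$, $K=(k_1,\dots,k_m)$, $a=\sum_i k_i$. For $\delta\in G\setminus\{0\}$ let $N_i(\delta)=|\{(b_i,b_j): b_i\in B_i,\ b_j\in\bigcup_{t\ne i}B_t,\ b_j-b_i=\delta\}|$. Then $\mathcal{B}$ is an $(n,m,K,a,d)$ reciprocally-weighted external difference family (RWEDF) if $\sum_{i=1}^m\frac{N_i(\delta)}{k_i}=d$ for each $\delta\in G\setminus\{0\}$. Weak AMD code: let $S$ be a set of $m$ source messages and $\mathcal{A}=\{A_s : s\in S\}$ a family of pairwise disjoint nonempty subsets of $G$. A source $s\in S$ is chosen uniformly at random, and $E_u$ encodes $s$ as a uniformly random $g\in A_s$. The adversary, with no knowledge of $s$ or $g$, chooses $\Delta\in G\setminus\{0\}$ and wins if $g+\Delta\in A_{s'}$ for some $s'\neq s$.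 Let $\rho_\Delta$ be the probability of winning with $\Delta$, i.e. $\rho_\Delta=\frac1m\sum_{s\in S}\frac{1}{|A_s|}\,|\{g\in A_s : g+\Delta\in\bigcup_{s'\ne s}A_{s'}\}|$. Then $(S,G,\mathcal{A},E_u)$ is a weak $(n,m,a,\rho)$-AMD code, where $a=\sum_{s\in S}|A_s|$ and $\rho=\max\{\rho_\Delta : \Delta\in G\setminus\{0\}\}$; it is $R$-optimal with respect to the Paterson–Stinson bound when $\rho=\frac{a(m-1)}{m(n-1)}$. Here $n\ge2$. *)

theory Defs
  imports "HOL-Probability.Probability"
begin

text \<open>The group \<open>G\<close> is the universe of a type \<open>'g\<close>; families are indexed by \<open>1, \<dots>, m\<close>.\<close>

definition ext_diff_count :: "nat \<Rightarrow> (nat \<Rightarrow> 'g::ab_group_add set) \<Rightarrow> nat \<Rightarrow> 'g \<Rightarrow> nat" where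
  "ext_diff_count m B i \<delta> =
     card {(x, y). x \<in> B i \<and> y \<in> (\<Union>t\<in>{1..m} - {i}. B t) \<and> y - x = \<delta>}"

definition RWEDF ::
  "nat \<Rightarrow> nat \<Rightarrow> (nat \<Rightarrow> nat) \<Rightarrow> nat \<Rightarrow> real \<Rightarrow> (nat \<Rightarrow> 'g::{finite, ab_group_add} set) \<Rightarrow> bool" where
  "RWEDF n m K a d B \<longleftrightarrow>
     n = CARD('g) \<and>
     disjoint_family_on B {1..m} \<and>
     (\<forall>i\<in>{1..m}. B i \<noteq> {} \<and> card (B i) = K i) \<and>
     a = (\<Sum>i\<in>{1..m}. K i) \<and>
     (\<forall>\<delta>::'g. \<delta> \<noteq> 0 \<longrightarrow> (\<Sum>i\<in>{1..m}. real (ext_diff_count m B i \<delta>) / real (K i)) = d)"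

definition uniform_encoding :: "('s \<Rightarrow> 'g set) \<Rightarrow> 's \<Rightarrow> 'g pmf" where
  "uniform_encoding A s = pmf_of_set (A s)"

definition win_prob :: "'s set \<Rightarrow> ('s \<Rightarrow> 'g::ab_group_add set) \<Rightarrow> 'g \<Rightarrow> real" where
  "win_prob S A \<Delta> =
     measure_pmf.prob
       (bind_pmf (pmf_of_set S) (\<lambda>s. map_pmf (Pair s) (uniform_encoding A s)))
       {(s, g). \<exists>s'\<in>S. s' \<noteq> s \<and> g + \<Delta> \<in> A s'}"

definition weak_AMD_code ::
  "nat \<Rightarrow> nat \<Rightarrow> nat \<Rightarrow> real \<Rightarrow> 's set \<Rightarrow> ('s \<Rightarrow> 'g::{finite, ab_group_add} set) \<Rightarrow> bool" where
  "weak_AMD_code n m a \<rho> S A \<longleftrightarrow>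
     n = CARD('g) \<and>
     finite S \<and> S \<noteq> {} \<and> card S = m \<and>
     disjoint_family_on A S \<and>
     (\<forall>s\<in>S. A s \<noteq> {}) \<and>
     a = (\<Sum>s\<in>S. card (A s)) \<and>
     \<rho> = Max (win_prob S A ` {\<Delta>. \<Delta> \<noteq> 0})"

lemma win_prob_eq:
  fixes A :: "'s \<Rightarrow> 'g::{finite, ab_group_add} set"
  assumes S: "finite S" "S \<noteq> {}" and A: "\<And>s. s \<in> S \<Longrightarrow> A s \<noteq> {}"
  shows "win_prob S A \<Delta> =
    1 / real (card S) *
      (\<Sum>s\<in>S. 1 / real (card (A s)) *
         real (card {g \<in> A s. g + \<Delta> \<in> (\<Union>s'\<in>S - {s}. A s')}))"
proof -
  have "measure_pmf.prob (map_pmf (Pair s) (uniform_encoding A s))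
          {(s, g). \<exists>s'\<in>S. s' \<noteq> s \<and> g + \<Delta> \<in> A s'} =
        1 / real (card (A s)) * real (card {g \<in> A s. g + \<Delta> \<in> (\<Union>s'\<in>S - {s}. A s')})"
    if "s \<in> S" for s
  proof -
    have "A s \<inter> Pair s -` {(s, g). \<exists>s'\<in>S. s' \<noteq> s \<and> g + \<Delta> \<in> A s'} =
          {g \<in> A s. g + \<Delta> \<in> (\<Union>s'\<in>S - {s}. A s')}"
      by auto
    then show ?thesis
      using A[OF that] by (simp add: uniform_encoding_def measure_pmf_of_set)
  qed
  note inner = this
  have "win_prob S A \<Delta> =
      (\<Sum>s\<in>S. measure_pmf.prob (map_pmf (Pair s) (uniform_encoding A s))
        {(s, g). \<exists>s'\<in>S. s' \<noteq> s \<and> g + \<Delta> \<in> A s'}) / real (card S)"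
    unfolding win_prob_def measure_pmf_bind
    using S
    by (subst measure_pmf.measure_bind[where N = "count_space UNIV"])
      (auto simp: integral_pmf_of_set space_subprob_algebra intro!: prob_space_imp_subprob_space measure_pmf.prob_space_axioms)
  also have "\<dots> = 1 / real (card S) *
      (\<Sum>s\<in>S. 1 / real (card (A s)) *
         real (card {g \<in> A s. g + \<Delta> \<in> (\<Union>s'\<in>S - {s}. A s')}))"
    by (subst sum.cong[OF refl inner]) simp_all
  finally show ?thesis .
qed

end

theory Submission
  imports Defs
begin

text \<open>
  Summing \<open>\<Sum>\<^sub>i N\<^sub>i(\<delta>) / k\<^sub>i\<close> over all \<open>\<delta> \<noteq> 0\<close> counts each pair of \<open>B\<^sub>i \<times> \<Union>\<^sub>t\<^sub>\<noteq>\<^sub>i B\<^sub>t\<close> once with weight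
  \<open>1 / k\<^sub>i\<close>, which gives \<open>\<Sum>\<^sub>i (a - k\<^sub>i) = a (m - 1)\<close>.  So \<open>a (m - 1) / (n - 1)\<close> is the average of the
  weighted count, and since \<open>\<rho>\<^sub>\<delta>\<close> is the weighted count divided by \<open>m\<close>, the maximum of \<open>\<rho>\<^sub>\<delta>\<close> equals
  \<open>a (m - 1) / (m (n - 1))\<close> iff the weighted count is constant.  The divisibility holds because
  \<open>d = a (m - 1) / (n - 1)\<close> becomes an integer after multiplication by the lcm of the \<open>k\<^sub>i\<close>.
\<close>

section \<open>Counting external differences\<close>

text \<open>A pair with difference \<open>\<delta>\<close> is determined by its first entry. The
  right-hand side is the set on which an adversary wins, as it occurs in
  \<open>win_prob_eq\<close>.\<close>

lemma ext_diff_count_eq: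
  "ext_diff_count m B i \<delta> = card {g \<in> B i. g + \<delta> \<in> (\<Union>t\<in>{1..m} - {i}. B t)}"
proof -
  have "bij_betw (\<lambda>g. (g, g + \<delta>)) {g \<in> B i. g + \<delta> \<in> (\<Union>t\<in>{1..m} - {i}. B t)}
      {(x, y). x \<in> B i \<and> y \<in> (\<Union>t\<in>{1..m} - {i}. B t) \<and> y - x = \<delta>}"
    by (rule bij_betw_byWitness[where f' = fst]) auto
  then show ?thesis
    unfolding ext_diff_count_def by (simp add: bij_betw_same_card)
qed

lemma card_nonzero: "card (- {0::'g::{finite, zero}}) = CARD('g) - 1"
  unfolding Compl_eq_Diff_UNIV by (rule card_Diff_singleton) simp

lemma card_rest_of_family:
  fixes B :: "nat \<Rightarrow> 'g::finite set"
  assumes "disjoint_family_on B {1..m}" "i \<in> {1..m}"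
  shows "card (\<Union>t\<in>{1..m} - {i}. B t) = (\<Sum>t\<in>{1..m}. card (B t)) - card (B i)"
proof -
  have "card (\<Union>t\<in>{1..m} - {i}. B t) = (\<Sum>t\<in>{1..m} - {i}. card (B t))"
    using assms(1) by (intro card_UN_disjoint) (auto simp: disjoint_family_on_def)
  also have "\<dots> = (\<Sum>t\<in>{1..m}. card (B t)) - card (B i)"
    using assms(2) by (simp add: sum_diff1_nat)
  finally show ?thesis .
qed

text \<open>Sort the pairs by their difference: disjointness excludes the difference
  \<open>0\<close>, so each pair is counted for exactly one \<open>\<delta>\<close> of the
  sum.\<close>

lemma sum_ext_diff_count:
  fixes B :: "nat \<Rightarrow> 'g::{finite, ab_group_add} set"
  assumes "disjoint_family_on B {1..m}" "i \<in> {1..m}"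
  shows "(\<Sum>\<delta>\<in>- {0}. ext_diff_count m B i \<delta>) =
    card (B i) * ((\<Sum>t\<in>{1..m}. card (B t)) - card (B i))"
proof -
  let ?P = "B i \<times> (\<Union>t\<in>{1..m} - {i}. B t)"
  have "B i \<inter> (\<Union>t\<in>{1..m} - {i}. B t) = {}"
    using assms by (fastforce simp: disjoint_family_on_def)
  then have nonzero: "(\<lambda>(x, y). y - x) ` ?P \<subseteq> - {0}"
    by auto
  have "(\<Sum>\<delta>\<in>- {0}. card {p \<in> ?P. (case p of (x, y) \<Rightarrow> y - x) = \<delta>}) = card ?P"
    unfolding card_eq_sum by (rule sum.group[OF _ _ nonzero]) simp_all
  moreover have "{p \<in> ?P. (case p of (x, y) \<Rightarrow> y - x) = \<delta>} =
      {(x, y). x \<in> B i \<and> y \<in> (\<Union>t\<in>{1..m} - {i}. B t) \<and> y - x = \<delta>}" for \<delta>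
    by auto
  ultimately show ?thesis
    by (simp only: ext_diff_count_def card_cartesian_product card_rest_of_family[OF assms])
qed

lemma sum_weighted_ext_diff_count:
  fixes B :: "nat \<Rightarrow> 'g::{finite, ab_group_add} set"
  assumes B: "disjoint_family_on B {1..m}"
    and K: "\<And>i. i \<in> {1..m} \<Longrightarrow> card (B i) = K i \<and> K i > 0"
  shows "(\<Sum>\<delta>\<in>- {0}. \<Sum>i\<in>{1..m}. real (ext_diff_count m B i \<delta>) / real (K i)) =
    real (\<Sum>i\<in>{1..m}. K i) * (real m - 1)"
proof -
  let ?a = "\<Sum>i\<in>{1..m}. K i"
  have a: "(\<Sum>t\<in>{1..m}. card (B t)) = ?a"
    using K by (intro sum.cong) auto
  have "(\<Sum>\<delta>\<in>- {0}. \<Sum>i\<in>{1..m}. real (ext_diff_count m B i \<delta>) / real (K i)) =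
      (\<Sum>i\<in>{1..m}. \<Sum>\<delta>\<in>- {0}. real (ext_diff_count m B i \<delta>) / real (K i))"
    by (rule sum.swap)
  also have "\<dots> = (\<Sum>i\<in>{1..m}. real ?a - real (K i))"
  proof (rule sum.cong[OF refl])
    fix i assume i: "i \<in> {1..m}"
    \<comment> \<open>The cardinality formula subtracts in \<open>nat\<close>; this bound makes that
      a true subtraction over the reals.\<close>
    have le: "K i \<le> ?a"
      using i by (intro member_le_sum) auto
    have "(\<Sum>\<delta>\<in>- {0}. real (ext_diff_count m B i \<delta>) / real (K i)) =
        real (\<Sum>\<delta>\<in>- {0}. ext_diff_count m B i \<delta>) / real (K i)"
      by (simp add: sum_divide_distrib)
    also have "\<dots> = real (K i * (?a - K i)) / real (K i)"
      using sum_ext_diff_count[OF B i] K[OF i] a by simp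
    also have "\<dots> = real ?a - real (K i)"
      using K[OF i] le by (simp add: of_nat_diff)
    finally show "(\<Sum>\<delta>\<in>- {0}. real (ext_diff_count m B i \<delta>) / real (K i)) =
      real ?a - real (K i)" .
  qed
  also have "\<dots> = real ?a * (real m - 1)"
    by (simp add: sum_subtractf algebra_simps)
  finally show ?thesis .
qed

section \<open>The value of \<open>d\<close> and the divisibility condition\<close>

text \<open>The total weight is the constant \<open>d\<close> taken once for each of the
  \<open>n - 1\<close> nonzero differences. The product form avoids division by zero at
  \<open>n = 1\<close>.\<close>

lemma RWEDF_weight_eq:
  fixes B :: "nat \<Rightarrow> 'g::{finite, ab_group_add} set"
  assumes R: "RWEDF n m K a d B" and K: "\<forall>i\<in>{1..m}. K i > 0"
  shows "(real n - 1) * d = real a * (real m - 1)"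
proof -
  have "(\<Sum>\<delta>\<in>- {0::'g}. \<Sum>i\<in>{1..m}. real (ext_diff_count m B i \<delta>) / real (K i)) =
      (\<Sum>\<delta>\<in>- {0::'g}. d)"
    using R by (intro sum.cong) (auto simp: RWEDF_def)
  moreover have "(\<Sum>\<delta>\<in>- {0::'g}. d) = (real n - 1) * d"
    using R by (simp add: RWEDF_def card_nonzero of_nat_diff Suc_leI)
  moreover have "(\<Sum>\<delta>\<in>- {0}. \<Sum>i\<in>{1..m}. real (ext_diff_count m B i \<delta>) / real (K i)) =
      real a * (real m - 1)"
    using R K sum_weighted_ext_diff_count[of B m K] by (auto simp: RWEDF_def)
  ultimately show ?thesis
    by metis
qed

text \<open>One nonzero \<open>\<delta>\<close> suffices: it writes \<open>d\<close> as a sum of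
  fractions with denominators \<open>K i\<close>, so \<open>?L * d\<close> is a natural number
  \<open>e\<close>, and \<open>e\<close> is the cofactor of \<open>n - 1\<close> in the weight
  equation multiplied by \<open>?L\<close>.\<close>

lemma RWEDF_imp_dvd:
  fixes B :: "nat \<Rightarrow> 'g::{finite, ab_group_add} set"
  assumes R: "RWEDF n m K a d B" and K: "\<forall>i\<in>{1..m}. K i > 0" and "n \<ge> 2" "m \<ge> 1"
  shows "(n - 1) dvd Lcm (K ` {1..m}) * a * (m - 1)"
proof -
  let ?L = "Lcm (K ` {1..m})"
  have "card (- {0::'g}) > 0"
    using R \<open>n \<ge> 2\<close> by (simp add: RWEDF_def card_nonzero)
  then obtain \<delta> :: 'g where "\<delta> \<noteq> 0"
    unfolding card_gt_0_iff by blast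
  then have d: "d = (\<Sum>i\<in>{1..m}. real (ext_diff_count m B i \<delta>) / real (K i))"
    using R by (simp add: RWEDF_def)
  have "real ?L * d = (\<Sum>i\<in>{1..m}. real (?L div K i * ext_diff_count m B i \<delta>))"
    unfolding d sum_distrib_left
  proof (rule sum.cong[OF refl])
    fix i assume "i \<in> {1..m}"
    \<comment> \<open>Divisibility makes \<open>?L div K i\<close> exact, so it agrees with the real
      quotient.\<close>
    then have "K i dvd ?L" "K i > 0"
      using K by (auto intro: dvd_Lcm)
    then show "real ?L * (real (ext_diff_count m B i \<delta>) / real (K i)) =
      real (?L div K i * ext_diff_count m B i \<delta>)"
      by (simp add: real_of_nat_div)
  qed
  then obtain e :: nat where e: "real ?L * d = real e"
    by (metis of_nat_sum)
  have "real (?L * a * (m - 1)) = real ?L * ((real n - 1) * d)"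
    using RWEDF_weight_eq[OF R K] \<open>m \<ge> 1\<close> by (simp add: of_nat_diff)
  also have "\<dots> = real ((n - 1) * e)"
    using e \<open>n \<ge> 2\<close> by (simp add: of_nat_diff)
  finally show ?thesis
    by (metis dvd_triv_left of_nat_eq_iff)
qed

section \<open>Winning probabilities and R-optimal codes\<close>

text \<open>The uniform source contributes \<open>1 / m\<close> and the uniform encoding
  \<open>1 / K i\<close>; the favourable encodings are counted by \<open>ext_diff_count\<close> once
  sources are renamed to indices along \<open>s\<close>.\<close>

lemma win_prob_eq_weighted_ext_diff_count:
  fixes B :: "nat \<Rightarrow> 'g::{finite, ab_group_add} set"
  assumes "m \<ge> 1" and s: "inj_on s {1..m}"
    and A: "\<And>i. i \<in> {1..m} \<Longrightarrow> A (s i) = B i"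
    and B: "\<And>i. i \<in> {1..m} \<Longrightarrow> card (B i) = K i \<and> B i \<noteq> {}"
  shows "win_prob (s ` {1..m}) A \<Delta> =
    (\<Sum>i\<in>{1..m}. real (ext_diff_count m B i \<Delta>) / real (K i)) / real m"
proof -
  have rest: "(\<Union>s'\<in>s ` {1..m} - {s i}. A s') = (\<Union>t\<in>{1..m} - {i}. B t)" if "i \<in> {1..m}" for i
  proof -
    \<comment> \<open>Injectivity of \<open>s\<close> is essential: another index with the same
      source would be removed as well.\<close>
    have "s ` {1..m} - {s i} = s ` ({1..m} - {i})"
      using s that by (simp add: inj_on_image_set_diff[of s "{1..m}"])
    then show ?thesis
      using A by simp
  qed
  have "win_prob (s ` {1..m}) A \<Delta> =
      1 / real (card (s ` {1..m})) * (\<Sum>r\<in>s ` {1..m}. 1 / real (card (A r)) *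
         real (card {g \<in> A r. g + \<Delta> \<in> (\<Union>s'\<in>s ` {1..m} - {r}. A s')}))"
    using \<open>m \<ge> 1\<close> A B by (intro win_prob_eq) auto
  also have "\<dots> = 1 / real m * (\<Sum>i\<in>{1..m}. 1 / real (card (A (s i))) *
         real (card {g \<in> A (s i). g + \<Delta> \<in> (\<Union>s'\<in>s ` {1..m} - {s i}. A s')}))"
    using s by (simp only: sum.reindex card_image o_def card_atLeastAtMost diff_Suc_1 add_diff_cancel_right')
  also have "(\<Sum>i\<in>{1..m}. 1 / real (card (A (s i))) *
         real (card {g \<in> A (s i). g + \<Delta> \<in> (\<Union>s'\<in>s ` {1..m} - {s i}. A s')})) =
      (\<Sum>i\<in>{1..m}. real (ext_diff_count m B i \<Delta>) / real (K i))"
  proof (rule sum.cong[OF refl])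
    fix i assume "i \<in> {1..m}"
    then show "1 / real (card (A (s i))) *
         real (card {g \<in> A (s i). g + \<Delta> \<in> (\<Union>s'\<in>s ` {1..m} - {s i}. A s')}) =
      real (ext_diff_count m B i \<Delta>) / real (K i)"
      by (simp only: rest ext_diff_count_eq A B) simp
  qed
  finally show ?thesis
    by simp
qed

text \<open>The hypothesis makes \<open>c\<close> the average of \<open>f\<close>. If
  \<open>c\<close> is also the maximum, the deviations \<open>c - f x\<close> are nonnegative with
  sum zero, so each vanishes.\<close>

lemma Max_eq_average_iff:
  fixes f :: "'a \<Rightarrow> real"
  assumes "finite X" "X \<noteq> {}" "(\<Sum>x\<in>X. f x) = real (card X) * c"
  shows "c = Max (f ` X) \<longleftrightarrow> (\<forall>x\<in>X. f x = c)"
proof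
  assume "c = Max (f ` X)"
  then have "\<forall>x\<in>X. 0 \<le> c - f x"
    using assms(1) by simp
  moreover have "(\<Sum>x\<in>X. c - f x) = 0"
    using assms(3) by (simp add: sum_subtractf)
  ultimately show "\<forall>x\<in>X. f x = c"
    using sum_nonneg_eq_0_iff[OF assms(1), of "\<lambda>x. c - f x"] by simp
next
  assume "\<forall>x\<in>X. f x = c"
  then have "f ` X = {c}"
    using assms(2) by auto
  then show "c = Max (f ` X)"
    by simp
qed

text \<open>The equivalence holds family by family: the same sets, indexed by numbers or by sources,
  form both objects.\<close>

lemma RWEDF_iff_weak_AMD_code:
  fixes B :: "nat \<Rightarrow> 'g::{finite, ab_group_add} set" and A :: "'s \<Rightarrow> 'g set"
  assumes n: "n = CARD('g)" "n \<ge> 2" and m: "m \<ge> 1"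
    and K: "\<forall>i\<in>{1..m}. K i > 0" and a: "a = (\<Sum>i\<in>{1..m}. K i)"
    and s: "inj_on s {1..m}" and A: "\<And>i. i \<in> {1..m} \<Longrightarrow> A (s i) = B i"
  shows "(\<exists>d. RWEDF n m K a d B) \<longleftrightarrow>
    weak_AMD_code n m a (real a * (real m - 1) / (real m * (real n - 1))) (s ` {1..m}) A \<and>
    (\<forall>i\<in>{1..m}. card (A (s i)) = K i)"
proof -
  have disjoint: "disjoint_family_on A (s ` {1..m}) \<longleftrightarrow> disjoint_family_on B {1..m}"
    using A by (simp add: disjoint_family_on_def inj_on_eq_iff[OF s])
  have nonempty: "(\<forall>r\<in>s ` {1..m}. A r \<noteq> {}) \<longleftrightarrow> (\<forall>i\<in>{1..m}. B i \<noteq> {})"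
    using A by simp
  have cards: "(\<forall>i\<in>{1..m}. card (A (s i)) = K i) \<longleftrightarrow> (\<forall>i\<in>{1..m}. card (B i) = K i)"
    using A by simp
  show ?thesis
  \<comment> \<open>Both sides contain these structural conditions, so both fail without them;
    otherwise only the conditions on \<open>d\<close> and \<open>?\<rho>\<close> remain to be
    compared.\<close>
  proof (cases "disjoint_family_on B {1..m} \<and> (\<forall>i\<in>{1..m}. B i \<noteq> {} \<and> card (B i) = K i)")
    case False
    have "\<not> RWEDF n m K a d B" for d
      using False unfolding RWEDF_def by blast
    moreover have "\<not> (weak_AMD_code n m a \<rho> (s ` {1..m}) A \<and> (\<forall>i\<in>{1..m}. card (A (s i)) = K i))" for \<rho>
      using False unfolding weak_AMD_code_def disjoint nonempty cards by blast
    ultimately show ?thesis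
      by blast
  next
    case True
    let ?F = "\<lambda>\<delta>. \<Sum>i\<in>{1..m}. real (ext_diff_count m B i \<delta>) / real (K i)"
    let ?d = "real a * (real m - 1) / (real n - 1)"
    let ?\<rho> = "real a * (real m - 1) / (real m * (real n - 1))"
    have R: "RWEDF n m K a d B \<longleftrightarrow> (\<forall>\<delta>. \<delta> \<noteq> 0 \<longrightarrow> ?F \<delta> = d)" for d
      using True n a by (simp add: RWEDF_def)
    \<comment> \<open>The weight equation leaves \<open>?d\<close> as the only possible constant,
      which removes the quantifier.\<close>
    have "(\<exists>d. RWEDF n m K a d B) \<longleftrightarrow> RWEDF n m K a ?d B"
    proof
      assume "\<exists>d. RWEDF n m K a d B"
      then obtain d where d: "RWEDF n m K a d B"
        by blast
      with RWEDF_weight_eq[OF d K] n(2) have "d = ?d"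
        by (simp add: field_simps)
      with d show "RWEDF n m K a ?d B"
        by simp
    qed blast
    also have "\<dots> \<longleftrightarrow> (\<forall>\<delta>\<in>{\<delta>. \<delta> \<noteq> 0}. win_prob (s ` {1..m}) A \<delta> = ?\<rho>)"
    proof -
      have "win_prob (s ` {1..m}) A \<delta> = ?F \<delta> / real m" for \<delta>
        using True by (intro win_prob_eq_weighted_ext_diff_count m s A) auto
      moreover have "?F \<delta> / real m = ?\<rho> \<longleftrightarrow> ?F \<delta> = ?d" for \<delta>
      proof -
        have "?\<rho> = ?d / real m"
          by (simp add: mult.commute)
        then show ?thesis
          using m by (simp only: divide_cancel_right) simp
      qed
      ultimately show ?thesis
        by (simp only: R mem_Collect_eq Ball_def)
    qed
    also have "\<dots> \<longleftrightarrow> ?\<rho> = Max (win_prob (s ` {1..m}) A ` {\<delta>. \<delta> \<noteq> 0})"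
    proof (rule Max_eq_average_iff[symmetric])
      have card: "card {\<delta>::'g. \<delta> \<noteq> 0} = n - 1"
        using n by (simp add: card_nonzero Collect_neg_eq)
      then show "{\<delta>::'g. \<delta> \<noteq> 0} \<noteq> {}"
        using n(2) card_gt_0_iff[of "{\<delta>::'g. \<delta> \<noteq> 0}"] by simp
      \<comment> \<open>The average of \<open>win_prob\<close> is \<open>?\<rho>\<close> for every
        such family, whether or not the weighted count is constant.\<close>
      have "(\<Sum>\<delta>\<in>{\<delta>. \<delta> \<noteq> 0}. win_prob (s ` {1..m}) A \<delta>) = (\<Sum>\<delta>\<in>- {0}. ?F \<delta> / real m)"
        using True by (intro sum.cong win_prob_eq_weighted_ext_diff_count m s A) auto
      also have "\<dots> = real a * (real m - 1) / real m"
        using True K a sum_weighted_ext_diff_count[of B m K] by (simp flip: sum_divide_distrib)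
      also have "\<dots> = real (card {\<delta>::'g. \<delta> \<noteq> 0}) * ?\<rho>"
        using card n(2) by (simp add: of_nat_diff)
      finally show "(\<Sum>\<delta>\<in>{\<delta>. \<delta> \<noteq> 0}. win_prob (s ` {1..m}) A \<delta>) =
        real (card {\<delta>::'g. \<delta> \<noteq> 0}) * ?\<rho>" .
    qed simp
    also have "\<dots> \<longleftrightarrow> weak_AMD_code n m a ?\<rho> (s ` {1..m}) A \<and> (\<forall>i\<in>{1..m}. card (A (s i)) = K i)"
    proof -
      have "a = (\<Sum>r\<in>s ` {1..m}. card (A r))"
        using a True A s by (simp add: sum.reindex)
      moreover have "card (s ` {1..m}) = m" "s ` {1..m} \<noteq> {}"
        using m s by (simp_all add: card_image)
      ultimately show ?thesis
        using n True unfolding weak_AMD_code_def disjoint nonempty cards by blast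
    qed
    finally show ?thesis .
  qed
qed

theorem corollary4:
  fixes n m a :: nat and K :: "nat \<Rightarrow> nat" and s :: "nat \<Rightarrow> 's" and S :: "'s set"
  assumes "n = CARD('g::{finite, ab_group_add})" and "n \<ge> 2"
    and "m \<ge> 1"
    and "\<forall>i\<in>{1..m}. K i > 0"
    and "a = (\<Sum>i\<in>{1..m}. K i)"
    and "inj_on s {1..m}" and "S = s ` {1..m}"
  shows
    "((\<exists>d. \<exists>B :: nat \<Rightarrow> 'g set. RWEDF n m K a d B) \<longleftrightarrow>
      (\<exists>\<rho>. \<exists>A :: 's \<Rightarrow> 'g set. weak_AMD_code n m a \<rho> S A \<and>
         (\<forall>i\<in>{1..m}. card (A (s i)) = K i) \<and>
         \<rho> = real a * (real m - 1) / (real m * (real n - 1)))) \<and>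
     ((\<exists>d. \<exists>B :: nat \<Rightarrow> 'g set. RWEDF n m K a d B) \<longrightarrow>
      (n - 1) dvd Lcm (K ` {1..m}) * a * (m - 1)) \<and>
     ((\<exists>\<rho>. \<exists>A :: 's \<Rightarrow> 'g set. weak_AMD_code n m a \<rho> S A \<and>
         (\<forall>i\<in>{1..m}. card (A (s i)) = K i) \<and>
         \<rho> = real a * (real m - 1) / (real m * (real n - 1))) \<longrightarrow>
      (n - 1) dvd Lcm (K ` {1..m}) * a * (m - 1))"
proof -
  let ?\<rho> = "real a * (real m - 1) / (real m * (real n - 1))"
  let ?code = "\<lambda>A :: 's \<Rightarrow> 'g set. weak_AMD_code n m a ?\<rho> S A \<and> (\<forall>i\<in>{1..m}. card (A (s i)) = K i)"
  note iff = RWEDF_iff_weak_AMD_code[where 'g = 'g, OF assms(1-6), folded assms(7)]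
  have "(\<exists>d. \<exists>B :: nat \<Rightarrow> 'g set. RWEDF n m K a d B) \<longleftrightarrow> (\<exists>A. ?code A)"
  proof
    assume "\<exists>d. \<exists>B :: nat \<Rightarrow> 'g set. RWEDF n m K a d B"
    then obtain B :: "nat \<Rightarrow> 'g set" where "\<exists>d. RWEDF n m K a d B"
      by blast
    moreover have "B (the_inv_into {1..m} s (s i)) = B i" if "i \<in> {1..m}" for i
      using the_inv_into_f_f[OF assms(6) that] by simp
    \<comment> \<open>Sources are read back as indices: on \<open>S\<close> the inverse of
      \<open>s\<close> recovers \<open>i\<close> from \<open>s i\<close>.\<close>
    ultimately have "?code (\<lambda>r. B (the_inv_into {1..m} s r))"
      using iff[of "\<lambda>r. B (the_inv_into {1..m} s r)" B] by blast
    then show "\<exists>A. ?code A"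
      by blast
  next
    assume "\<exists>A. ?code A"
    then obtain A where "?code A"
      by blast
    then show "\<exists>d. \<exists>B :: nat \<Rightarrow> 'g set. RWEDF n m K a d B"
      using iff[of A "\<lambda>i. A (s i)"] by blast
  qed
  moreover have "(\<exists>d. \<exists>B :: nat \<Rightarrow> 'g set. RWEDF n m K a d B) \<longrightarrow>
      (n - 1) dvd Lcm (K ` {1..m}) * a * (m - 1)"
    using RWEDF_imp_dvd assms(2-4) by blast
  ultimately show ?thesis
    by blast
qed

end
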